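(* Let $p_n^{\text{card}}(\text{id},\cdot)$ be the distribution on $S_n$ of the card cyclic to random transposition shuffle started from the identity permutation. (i) Let $(b_n)_{n\ge 1}$ and $(x_n)_{n\ge1}$ be sequences such that $b_nn$ and $x_nn$ are integers in $[n]$ for every $n$, and assume that $\lim_{n\to\infty}b_n=b\in[0,1]$ and $\lim_{n\to\infty}x_n=x\in[0,1]$. Then, for the position $\sigma^{-1}_{b_nn}$ of card number $b_nn$, $$ f^{\text{card}}_b(x)\equiv\lim_{n\to\infty}n\,p_n^{\text{card}}(\text{id},\{\sigma^{-1}_{b_nn}=x_nn\})= \begin{cases} e^{-1+b}+e^{-x}-e^{-1-x+b},& x<b;\\ e^{-1+b}+e^{-x},& x>b. \end{cases} $$ (ii) Let $(x_n)_{n\ge1}$ and $(b_n)_{n\ge 1}$ be sequences such that $x_nn$ and $b_nn$ are integers in $[n]$ for every $n$, and assume that $\lim_{n\to\infty}x_n=x\in[0,1]$ and $\lim_{n\to\infty}b_n=b\in[0,1]$. Then, for the number $\sigma_{x_nn}$ of the card in position $x_nn$, $$ h^{\text{card}}_x(b)\equiv\lim_{n\to\infty}n\,p_n^{\text{card}}(\text{id},\{\sigma_{x_nn}=b_nn\})= \begin{cases} e^{-1+b}+e^{-x},& b<x;\\ e^{-1+b}+e^{-x}-e^{-1-x+b},& b>x.\end{cases} $$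
   Context: $S_n$ is the symmetric group of permutations of $[n]=\{1,\dots,n\}$. A permutation $\sigma\in S_n$ is viewed as a deck of cards numbered $1$ to $n$ laid out in a row, where $\sigma_j$ denotes the number of the card in the $j$-th position from the left; $\sigma^{-1}_j$ denotes the position occupied by card number $j$. The card cyclic to random transposition shuffle, started from a given $\sigma\in S_n$, consists of $n$ steps performed in order $j=1,\dots,n$: on the $j$-th step, transpose (exchange the positions of) the card that was originally (i.e. in the starting arrangement $\sigma$) the $j$-th from the left with a card chosen uniformly at random from all $n$ cards (possibly itself), the choices at different steps being independent. The distribution on $S_n$ of the arrangement after the $n$ steps is denoted $p_n^{\text{card}}(\sigma,\cdot)$; $\text{id}$ is the identity permutation, so starting from $\text{id}$ the card moved on step $j$ is card number $j$. *)

theory Defs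
  imports "HOL-Probability.Probability" "HOL-Combinatorics.Permutations"
begin

text \<open>
  An arrangement of the deck is a function \<open>\<tau>\<close> with \<open>\<tau> permutes {1..n}\<close>; \<open>\<tau> i\<close> is the number
  of the card in position \<open>i\<close>, and \<open>inv \<tau> c\<close> is the position of card \<open>c\<close>. Exchanging the positions
  of the cards \<open>a\<close> and \<open>c\<close> therefore acts on the values of \<open>\<tau>\<close>, i.e. by composition on the left.
\<close>

definition exchange_cards :: "nat \<Rightarrow> nat \<Rightarrow> (nat \<Rightarrow> nat) \<Rightarrow> (nat \<Rightarrow> nat)" where
  "exchange_cards a c \<tau> = Transposition.transpose a c \<circ> \<tau>"

text \<open>
  Distribution after the first \<open>k\<close> steps. The card moved in step \<open>Suc k\<close> is determined by the
  starting arrangement \<open>\<sigma>\<close>, not by the current arrangement \<open>\<tau>\<close>.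
\<close>

primrec card_cyclic_steps :: "nat \<Rightarrow> (nat \<Rightarrow> nat) \<Rightarrow> nat \<Rightarrow> (nat \<Rightarrow> nat) pmf" where
  "card_cyclic_steps n \<sigma> 0 = return_pmf \<sigma>"
| "card_cyclic_steps n \<sigma> (Suc k) =
     bind_pmf (card_cyclic_steps n \<sigma> k)
       (\<lambda>\<tau>. map_pmf (\<lambda>c. exchange_cards (\<sigma> (Suc k)) c \<tau>) (pmf_of_set {1..n}))"

definition p_card :: "nat \<Rightarrow> (nat \<Rightarrow> nat) \<Rightarrow> (nat \<Rightarrow> nat) pmf" where
  "p_card n \<sigma> = card_cyclic_steps n \<sigma> n"

lemma card_cyclic_steps_permutes:
  assumes "\<sigma> permutes {1..n}" and "k \<le> n" and "\<tau> \<in> set_pmf (card_cyclic_steps n \<sigma> k)"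
  shows "\<tau> permutes {1..n}"
  using assms(2,3)
proof (induction k arbitrary: \<tau>)
  case 0
  then show ?case using assms(1) by simp
next
  case (Suc k)
  then have "n \<ge> 1" by simp
  with Suc.prems obtain \<rho> c where \<rho>: "\<rho> \<in> set_pmf (card_cyclic_steps n \<sigma> k)" and c: "c \<in> {1..n}"
    and \<tau>: "\<tau> = exchange_cards (\<sigma> (Suc k)) c \<rho>"
    by auto
  have "\<rho> permutes {1..n}" using Suc.IH[OF _ \<rho>] Suc.prems(1) by simp
  moreover have "\<sigma> (Suc k) \<in> {1..n}"
    using Suc.prems(1) permutes_in_image[OF assms(1), of "Suc k"] by simp
  ultimately show ?case
    unfolding \<tau> exchange_cards_def using c by (intro permutes_compose permutes_swap_id)
qed

lemma p_card_permutes: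
  "\<sigma> permutes {1..n} \<Longrightarrow> \<tau> \<in> set_pmf (p_card n \<sigma>) \<Longrightarrow> \<tau> permutes {1..n}"
  unfolding p_card_def by (rule card_cyclic_steps_permutes) auto

end

theory Submission
  imports Defs
begin

text \<open>
  Follow a position rather than a card. The number of the card lying in a fixed position \<open>y\<close> is by
  itself a Markov chain on \<open>{1..n}\<close>: in step \<open>j\<close> it is replaced by a uniform number if it
  equals \<open>j\<close>, and otherwise it becomes \<open>j\<close> with probability \<open>1/n\<close> and stays put with
  probability \<open>r = 1 - 1/n\<close>. Whatever the past, the position thus holds card \<open>j\<close> after step
  \<open>j\<close> with probability exactly \<open>1/n\<close>. The probabilities of the other values \<open>m\<close> obey a linear
  recursion (\<open>prob_content_Suc\<close>) whose only inhomogeneity is the probability that the position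
  holds card \<open>j\<close> just before step \<open>j\<close>.

  This inhomogeneity can be computed. Up to step \<open>y - 1\<close> the position holds either its original
  card \<open>y\<close> or a card already moved by its own step, so for \<open>j < y\<close> the inhomogeneity
  vanishes, and for \<open>j = y\<close> it is \<open>r\<^bsup>y - 1\<^esup>\<close>, the probability that the original card has
  survived. In step \<open>y\<close> this mass is spread uniformly, so each later card receives
  \<open>r\<^bsup>y - 1\<^esup> / n\<close>. Thereafter the cards still to be moved are equally likely: in a step,
  each of them loses a fraction \<open>1/n\<close> of its probability to the moving card and gains a fraction
  \<open>1/n\<close> of the equal probability that the moving card had. Hence the inhomogeneity is
  \<open>r\<^bsup>y - 1\<^esup> / n\<close> for every \<open>j > y\<close>.

  So the recursion has a closed solution (\<open>prob_content_unmoved\<close>, \<open>prob_content_moved\<close>), and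
  after \<open>n\<close> steps \<open>n P(\<sigma> y = m)\<close> equals \<open>r\<^bsup>n - m\<^esup> + r\<^bsup>y - 1\<^esup>\<close> for \<open>m < y\<close> and
  \<open>r\<^bsup>n - m\<^esup> + r\<^bsup>y - 1\<^esup> (1 - r\<^bsup>n - m\<^esup>)\<close> for \<open>m \<ge> y\<close>.
  The limits follow from \<open>(1 - 1/n)\<^bsup>k\<^esup> \<rightarrow> exp (-t)\<close> when \<open>k/n \<rightarrow> t\<close>. Both parts of
  the theorem concern the same event, because \<open>\<sigma>\<^sup>-\<^sup>1 m = y\<close> means \<open>\<sigma> y = m\<close>.
\<close>

section \<open>The card in a fixed position\<close>

definition content :: "nat \<Rightarrow> nat \<Rightarrow> nat \<Rightarrow> nat pmf" where
  "content n y k = map_pmf (\<lambda>\<tau>. \<tau> y) (card_cyclic_steps n id k)"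

lemma content_0: "content n y 0 = return_pmf y"
  by (simp add: content_def)

lemma content_Suc:
  "content n y (Suc k) = bind_pmf (content n y k)
     (\<lambda>v. map_pmf (\<lambda>c. Transposition.transpose (Suc k) c v) (pmf_of_set {1..n}))"
  by (simp add: content_def map_bind_pmf bind_map_pmf map_pmf_comp exchange_cards_def)

lemma set_content:
  assumes "k \<le> n" "y \<in> {1..n}" "v \<in> set_pmf (content n y k)"
  shows "v \<in> {1..n}"
proof -
  obtain \<tau> where "\<tau> \<in> set_pmf (card_cyclic_steps n id k)" "v = \<tau> y"
    using assms(3) by (auto simp: content_def)
  with card_cyclic_steps_permutes[OF permutes_id assms(1)] assms(2) show ?thesis
    by (metis permutes_in_image)
qed

lemma pmf_transpose_uniform:
  fixes n j v m :: nat
  assumes "v \<in> {1..n}" "m \<in> {1..n}"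
  shows "pmf (map_pmf (\<lambda>c. Transposition.transpose j c v) (pmf_of_set {1..n})) m =
     (if m = j then 1 / n
      else 1 / n * indicator {j} v + (1 - 1 / n) * indicator {m} v)"
proof -
  let ?A = "{1..n} \<inter> {c. Transposition.transpose j c v = m}"
  have n: "n > 0" using assms by auto
  have "pmf (map_pmf (\<lambda>c. Transposition.transpose j c v) (pmf_of_set {1..n})) m =
      real (card ?A) / n"
    using n by (simp add: pmf_map vimage_def measure_pmf_of_set)
  moreover have "?A = (if m = j \<or> v = j then {if m = j then v else m}
      else if v = m then {1..n} - {m} else {})"
    using assms by (auto simp: Transposition.transpose_def)
  ultimately show ?thesis
    using assms n by (auto simp: of_nat_diff diff_divide_distrib)
qed

text \<open>The moving card \<open>Suc k\<close> arrives exactly when it is exchanged with the card now in the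
  position, whichever that is, hence with probability \<open>1/n\<close>. Any other card arrives only by being
  exchanged with a moving card that lies there, and leaves only by being chosen.\<close>

lemma prob_content_Suc:
  assumes "k < n" "y \<in> {1..n}" "m \<in> {1..n}"
  shows "pmf (content n y (Suc k)) m =
     (if m = Suc k then 1 / n
      else (1 - 1 / n) * pmf (content n y k) m + pmf (content n y k) (Suc k) / n)"
proof -
  let ?M = "measure_pmf (content n y k)"
  have "pmf (content n y (Suc k)) m = (\<integral>v. (if m = Suc k then 1 / n
      else 1 / n * indicator {Suc k} v + (1 - 1 / n) * indicator {m} v) \<partial>?M)"
    unfolding content_Suc pmf_bind
  proof (intro integral_cong_AE)
    show "AE v in ?M. pmf (map_pmf (\<lambda>c. Transposition.transpose (Suc k) c v) (pmf_of_set {1..n})) m =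
        (if m = Suc k then 1 / n
         else 1 / n * indicator {Suc k} v + (1 - 1 / n) * indicator {m} v)"
      unfolding AE_measure_pmf_iff
      using assms set_content[of k n y] by (intro ballI pmf_transpose_uniform) auto
  qed auto
  also have "\<dots> = (if m = Suc k then 1 / n
      else (1 - 1 / n) * pmf (content n y k) m + pmf (content n y k) (Suc k) / n)"
  proof (cases "m = Suc k")
    case False
    have "integrable ?M (indicator A :: nat \<Rightarrow> real)" for A
      by (simp add: measure_pmf.emeasure_eq_measure)
    with False show ?thesis by (simp add: measure_pmf_single)
  qed simp
  finally show ?thesis .
qed

section \<open>Closed form of the probabilities\<close>

text \<open>Before step \<open>y\<close>, a card other than \<open>y\<close> whose own step is still to come cannot
  reach position \<open>y\<close>. In step \<open>y\<close> all such cards receive the same share of the surviving mass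
  of card \<open>y\<close>, and from then on loss and gain balance, because the factor \<open>r\<close> and the share
  \<open>1/n\<close> act on equal probabilities. The induction is over all these cards at once, since the gain
  of \<open>m\<close> comes from \<open>Suc k\<close>.\<close>

lemma prob_content_unmoved:
  assumes "k < m" "m \<le> n" "y \<in> {1..n}"
  shows "pmf (content n y k) m =
     (if k < y then (if m = y then (1 - 1 / n) ^ k else 0) else (1 - 1 / n) ^ (y - 1) / n)"
  using assms(1,2)
proof (induction k arbitrary: m)
  case 0
  then show ?case using assms(3) by (auto simp: content_0)
next
  case (Suc k)
  define r :: real where "r = 1 - 1 / n"
  have "pmf (content n y (Suc k)) m =
      r * pmf (content n y k) m + pmf (content n y k) (Suc k) / n"
    using Suc.prems assms(3) by (subst prob_content_Suc) (auto simp: r_def)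
  also have "\<dots> = r * (if k < y then (if m = y then r ^ k else 0) else r ^ (y - 1) / n)
      + (if k < y then (if Suc k = y then r ^ k else 0) else r ^ (y - 1) / n) * (1 - r)"
    using Suc.IH[of m] Suc.IH[of "Suc k"] Suc.prems by (simp add: r_def)
  also have "\<dots> = (if Suc k < y then (if m = y then r ^ Suc k else 0) else r ^ (y - 1) / n)"
  proof (cases "y \<le> k")
    case True
    have "r * z + z * (1 - r) = z" for z :: real by (simp add: algebra_simps)
    from this[of "r ^ (y - 1) / n"] True show ?thesis by simp
  next
    case False
    with Suc.prems show ?thesis by (cases "Suc k = y") (auto simp: r_def)
  qed
  finally show ?case by (simp add: r_def)
qed

text \<open>Step \<open>m\<close> resets the probability to \<open>1/n\<close>, which then decays by the factor \<open>r\<close> per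
  step; this is the first summand. The second one collects the gains from the later moving cards,
  which the preceding lemma determines. If \<open>m < y\<close>, card \<open>m\<close> takes part in the uniform
  spreading at step \<open>y\<close> and then keeps its share, in the same balance as an unmoved card. If
  \<open>m \<ge> y\<close>, the gains start from \<open>0\<close> at step \<open>m\<close> and approach this balanced value
  geometrically.\<close>

lemma prob_content_moved:
  assumes "1 \<le> m" "m \<le> k" "k \<le> n" "y \<in> {1..n}"
  shows "n * pmf (content n y k) m = (1 - 1 / n) ^ (k - m) +
     (if k < y then 0
      else if m < y then (1 - 1 / n) ^ (y - 1)
      else (1 - 1 / n) ^ (y - 1) * (1 - (1 - 1 / n) ^ (k - m)))"
  using assms(2,3)
proof (induction k rule: dec_induct)
  case base
  then have "pmf (content n y (Suc (m - 1))) m = 1 / n"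
    using assms by (subst prob_content_Suc) auto
  then show ?case using assms by auto
next
  case (step k)
  define r :: real where "r = 1 - 1 / n"
  have n: "real n > 0" using assms by auto
  have "n * pmf (content n y (Suc k)) m =
      r * (n * pmf (content n y k) m) + pmf (content n y k) (Suc k)"
    using prob_content_Suc[of k n y m] step.hyps step.prems assms n
    by (simp add: r_def distrib_left)
  also have "n * pmf (content n y k) m = r ^ (k - m) + (if k < y then 0
      else if m < y then r ^ (y - 1) else r ^ (y - 1) * (1 - r ^ (k - m)))"
    unfolding r_def by (rule step.IH) (use step in simp)
  also have "pmf (content n y k) (Suc k) =
      (if k < y then (if Suc k = y then r ^ k else 0) else r ^ (y - 1) * (1 - r))"
    using step assms(4) by (subst prob_content_unmoved) (auto simp: r_def)
  finally show ?case
    using step.hyps unfolding r_def[symmetric]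
    by (cases "y = Suc k") (auto simp: Suc_diff_le algebra_simps)
qed

text \<open>Outside the permutations the event on the left need not agree with \<open>\<sigma> y = m\<close>, since
  \<open>inv\<close> is then arbitrary; those functions have probability \<open>0\<close>.\<close>

lemma prob_position_eq_content:
  "measure_pmf.prob (p_card n id) {\<sigma>. inv \<sigma> m = y} = pmf (content n y n) m"
proof -
  have "inv \<tau> m = y \<longleftrightarrow> \<tau> y = m" if "\<tau> \<in> set_pmf (p_card n id)" for \<tau>
    using permutes_inv_eq[OF p_card_permutes[OF permutes_id that]] .
  then have "measure_pmf.prob (p_card n id) {\<sigma>. inv \<sigma> m = y} =
      measure_pmf.prob (p_card n id) {\<sigma>. \<sigma> y = m}"
    by (intro measure_pmf.finite_measure_eq_AE) (auto simp: AE_measure_pmf_iff)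
  then show ?thesis by (simp add: content_def p_card_def pmf_map vimage_def)
qed

lemma prob_card_eq_content:
  "measure_pmf.prob (p_card n id) {\<sigma>. \<sigma> y = m} = pmf (content n y n) m"
  by (simp add: content_def p_card_def pmf_map vimage_def)

section \<open>Passage to the limit\<close>

lemma power_one_minus_inverse_tendsto:
  fixes k :: "nat \<Rightarrow> nat"
  assumes "(\<lambda>n. real (k n) / n) \<longlonglongrightarrow> t"
  shows "(\<lambda>n. (1 - 1 / real n) ^ k n) \<longlonglongrightarrow> exp (- t)"
proof -
  have "(\<lambda>n. real n * ln (1 - 1 / real n)) \<longlonglongrightarrow> -1"
    by real_asymp
  from tendsto_exp[OF tendsto_mult[OF assms this]]
  have "(\<lambda>n. exp (real (k n) / n * (real n * ln (1 - 1 / real n)))) \<longlonglongrightarrow> exp (- t)"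
    by simp
  moreover have "\<forall>\<^sub>F n in sequentially.
      exp (real (k n) / n * (real n * ln (1 - 1 / real n))) = (1 - 1 / real n) ^ k n"
    using eventually_ge_at_top[of 2]
    by eventually_elim (simp add: exp_of_nat_mult)
  ultimately show ?thesis by (rule Lim_transform_eventually)
qed

lemma eventually_less_of_limits_less:
  fixes f g :: "nat \<Rightarrow> real"
  assumes "f \<longlonglongrightarrow> a" "g \<longlonglongrightarrow> c" "a < c"
  shows "\<forall>\<^sub>F n in sequentially. f n < g n"
proof -
  obtain d where "a < d" "d < c" using assms(3) dense by blast
  with assms have "\<forall>\<^sub>F n in sequentially. f n < d" "\<forall>\<^sub>F n in sequentially. d < g n"
    by (auto intro: order_tendstoD)
  then show ?thesis by eventually_elim simp
qed

theorem theorem1: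
  fixes b_seq x_seq :: "nat \<Rightarrow> real" and B X :: "nat \<Rightarrow> nat" and b x :: real
  assumes B: "\<And>n. n \<ge> 1 \<Longrightarrow> b_seq n * real n = real (B n) \<and> B n \<in> {1..n}"
    and X: "\<And>n. n \<ge> 1 \<Longrightarrow> x_seq n * real n = real (X n) \<and> X n \<in> {1..n}"
    and b: "b_seq \<longlonglongrightarrow> b" "b \<in> {0..1}"
    and x: "x_seq \<longlonglongrightarrow> x" "x \<in> {0..1}"
  shows
    "((x < b \<longrightarrow>
        (\<lambda>n. real n * measure_pmf.prob (p_card n id) {\<sigma>. inv \<sigma> (B n) = X n})
          \<longlonglongrightarrow> exp (-1 + b) + exp (-x) - exp (-1 - x + b)) \<and>
      (x > b \<longrightarrow>
        (\<lambda>n. real n * measure_pmf.prob (p_card n id) {\<sigma>. inv \<sigma> (B n) = X n})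
          \<longlonglongrightarrow> exp (-1 + b) + exp (-x))) \<and>
     ((b < x \<longrightarrow>
        (\<lambda>n. real n * measure_pmf.prob (p_card n id) {\<sigma>. \<sigma> (X n) = B n})
          \<longlonglongrightarrow> exp (-1 + b) + exp (-x)) \<and>
      (b > x \<longrightarrow>
        (\<lambda>n. real n * measure_pmf.prob (p_card n id) {\<sigma>. \<sigma> (X n) = B n})
          \<longlonglongrightarrow> exp (-1 + b) + exp (-x) - exp (-1 - x + b)))"
proof -
  let ?r = "\<lambda>n. 1 - 1 / real n"
  let ?P = "\<lambda>n. real n * pmf (content n (X n) n) (B n)"
  have "(\<lambda>n. 1 - b_seq n) \<longlonglongrightarrow> 1 - b" by (intro tendsto_intros b)
  moreover have "\<forall>\<^sub>F n in sequentially. 1 - b_seq n = real (n - B n) / n"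
    using eventually_ge_at_top[of 1]
    by eventually_elim (use B in \<open>auto simp: field_simps of_nat_diff\<close>)
  ultimately have "(\<lambda>n. real (n - B n) / n) \<longlonglongrightarrow> 1 - b"
    by (rule Lim_transform_eventually)
  from power_one_minus_inverse_tendsto[OF this]
  have limB: "(\<lambda>n. ?r n ^ (n - B n)) \<longlonglongrightarrow> exp (-1 + b)" by simp
  have "(\<lambda>n. x_seq n - 1 / real n) \<longlonglongrightarrow> x - 0"
    by (intro tendsto_diff x lim_1_over_n)
  moreover have "\<forall>\<^sub>F n in sequentially. x_seq n - 1 / real n = real (X n - 1) / n"
    using eventually_ge_at_top[of 1]
    by eventually_elim (use X in \<open>auto simp: field_simps of_nat_diff\<close>)
  ultimately have "(\<lambda>n. real (X n - 1) / n) \<longlonglongrightarrow> x - 0"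
    by (rule Lim_transform_eventually)
  from power_one_minus_inverse_tendsto[OF this]
  have limX: "(\<lambda>n. ?r n ^ (X n - 1)) \<longlonglongrightarrow> exp (-x)" by simp

  have lt_iff: "x_seq n < b_seq n \<longleftrightarrow> X n < B n" "b_seq n < x_seq n \<longleftrightarrow> B n < X n"
    if "n \<ge> 1" for n
  proof -
    have "b_seq n = B n / n" "x_seq n = X n / n"
      using B[OF that] X[OF that] that by (simp_all add: field_simps)
    then show "x_seq n < b_seq n \<longleftrightarrow> X n < B n" "b_seq n < x_seq n \<longleftrightarrow> B n < X n"
      using that by (simp_all add: divide_less_cancel)
  qed

  have below: "?P \<longlonglongrightarrow> exp (-1 + b) + exp (-x) - exp (-1 - x + b)" if "x < b"
  proof -
    have "(\<lambda>n. ?r n ^ (n - B n) + ?r n ^ (X n - 1) * (1 - ?r n ^ (n - B n)))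
        \<longlonglongrightarrow> exp (-1 + b) + exp (-x) * (1 - exp (-1 + b))"
      by (intro tendsto_intros limB limX)
    moreover have "\<forall>\<^sub>F n in sequentially.
        ?r n ^ (n - B n) + ?r n ^ (X n - 1) * (1 - ?r n ^ (n - B n)) = ?P n"
      using eventually_less_of_limits_less[OF x(1) b(1) that] eventually_ge_at_top[of 1]
    proof eventually_elim
      case (elim n)
      then show ?case using B[of n] X[of n] lt_iff[of n]
        by (subst prob_content_moved) auto
    qed
    ultimately have "?P \<longlonglongrightarrow> exp (-1 + b) + exp (-x) * (1 - exp (-1 + b))"
      by (rule Lim_transform_eventually)
    then show ?thesis by (simp add: algebra_simps flip: exp_add)
  qed

  have above: "?P \<longlonglongrightarrow> exp (-1 + b) + exp (-x)" if "b < x"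
  proof -
    have "(\<lambda>n. ?r n ^ (n - B n) + ?r n ^ (X n - 1)) \<longlonglongrightarrow> exp (-1 + b) + exp (-x)"
      by (intro tendsto_intros limB limX)
    moreover have "\<forall>\<^sub>F n in sequentially. ?r n ^ (n - B n) + ?r n ^ (X n - 1) = ?P n"
      using eventually_less_of_limits_less[OF b(1) x(1) that] eventually_ge_at_top[of 1]
    proof eventually_elim
      case (elim n)
      then show ?case using B[of n] X[of n] lt_iff[of n]
        by (subst prob_content_moved) auto
    qed
    ultimately show ?thesis by (rule Lim_transform_eventually)
  qed

  show ?thesis
    unfolding prob_position_eq_content prob_card_eq_content using below above by blast
qed

end
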